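(* Let $\mathbf{G}$ be a positively weighted graph, let $s,t$ be vertices, and let $F\subseteq E(T_{\mathbf{G}}(s))$ be a set of edges such that the subtrees $T_{\mathbf{G}}(s,e)$ for distinct $e\in F$ are pairwise disjoint. Let $S=\bigcup_{e\in F}V(T_{\mathbf{G}}(s,e))$. If $t\in S$, then there is an edge $\{x,y\}\in E_{\mathbf{G}}(V(\mathbf{G})\setminus S,\,S)$ with $\{x,y\}\notin F$ such that $$\pi_{\mathbf{G}\setminus F}(s,t)=\pi_{\mathbf{G}}(s,x)\circ\{x,y\}\circ\pi_{\mathbf{G}\setminus F}(y,t),$$ and moreover for such $x,y$ the path $\pi_{\mathbf{G}\setminus F}(y,t)$ contains only vertices of $S$.
   Context: For every graph $\mathbf{H}$ under consideration (including subgraphs $\mathbf{G}\setminus F$ obtained by deleting edge sets $F$) and every pair of nodes $x,y$, a canonical shortest path $\pi_{\mathbf{H}}(x,y)$ is fixed; canonical paths are closed under subpaths (if $z\in\pi_{\mathbf{H}}(x,y)$ then $\pi_{\mathbf{H}}(x,y)=\pi_{\mathbf{H}}(x,z)\circ\pi_{\mathbf{H}}(z,y)$) and consistent with edge removals (if $e\notin\pi_{\mathbf{H}}(x,y)$ then $\pi_{\mathbf{H}\setminus e}(x,y)=\pi_{\mathbf{H}}(x,y)$). $\circ$ denotes concatenation. $T_{\mathbf{G}}(s)$ is the shortest path tree of $s$ consistent with the canonical paths; for an edge $e$ of it, $T_{\mathbf{G}}(s,e)$ is the subtree of $T_{\mathbf{G}}(s)$ below $e$. $E_{\mathbf{G}}(A,B)=E(\mathbf{G})\cap(A\times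 B)$. *)

theory Defs
  imports Complex_Main
begin

text \<open>Subgraphs G \ F are represented
by their edge set (E - F) over the same vertex set V.\<close>

definition wf_graph :: "'a set \<Rightarrow> 'a set set \<Rightarrow> ('a set \<Rightarrow> real) \<Rightarrow> bool" where
  "wf_graph V E w \<longleftrightarrow> finite V \<and>
     (\<forall>e\<in>E. \<exists>u v. u \<noteq> v \<and> u \<in> V \<and> v \<in> V \<and> e = {u, v}) \<and>
     (\<forall>e\<in>E. w e > 0)"

definition path_edges :: "'a list \<Rightarrow> 'a set set" where
  "path_edges xs = set (map (\<lambda>(a, b). {a, b}) (zip xs (tl xs)))"

definition is_path :: "'a set \<Rightarrow> 'a set set \<Rightarrow> 'a list \<Rightarrow> 'a \<Rightarrow> 'a \<Rightarrow> bool" where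
  "is_path V H xs x y \<longleftrightarrow> xs \<noteq> [] \<and> hd xs = x \<and> last xs = y \<and>
     set xs \<subseteq> V \<and> path_edges xs \<subseteq> H"

definition path_weight :: "('a set \<Rightarrow> real) \<Rightarrow> 'a list \<Rightarrow> real" where
  "path_weight w xs = sum_list (map (\<lambda>(a, b). w {a, b}) (zip xs (tl xs)))"

definition connected_in :: "'a set \<Rightarrow> 'a set set \<Rightarrow> 'a \<Rightarrow> 'a \<Rightarrow> bool" where
  "connected_in V H x y \<longleftrightarrow> (\<exists>xs. is_path V H xs x y)"

definition is_shortest_path ::
  "'a set \<Rightarrow> 'a set set \<Rightarrow> ('a set \<Rightarrow> real) \<Rightarrow> 'a list \<Rightarrow> 'a \<Rightarrow> 'a \<Rightarrow> bool" where
  "is_shortest_path V H w xs x y \<longleftrightarrow> is_path V H xs x y \<and>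
     (\<forall>ys. is_path V H ys x y \<longrightarrow> path_weight w xs \<le> path_weight w ys)"

text \<open>A canonical shortest path system cp: for every subgraph H (edge set H \<subseteq> E)
and every connected pair x,y, cp H x y is a shortest x-y path in (V,H); the system
is closed under subpaths and consistent with edge removals.\<close>

definition canonical_paths ::
  "'a set \<Rightarrow> 'a set set \<Rightarrow> ('a set \<Rightarrow> real) \<Rightarrow> ('a set set \<Rightarrow> 'a \<Rightarrow> 'a \<Rightarrow> 'a list) \<Rightarrow> bool" where
  "canonical_paths V E w cp \<longleftrightarrow>
     (\<forall>H x y. H \<subseteq> E \<and> connected_in V H x y \<longrightarrow>
        is_shortest_path V H w (cp H x y) x y) \<and>
     (\<forall>H x y z. H \<subseteq> E \<and> connected_in V H x y \<and> z \<in> set (cp H x y) \<longrightarrow>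
        cp H x y = cp H x z @ tl (cp H z y)) \<and>
     (\<forall>H x y e. H \<subseteq> E \<and> connected_in V H x y \<and> e \<notin> path_edges (cp H x y) \<longrightarrow>
        cp (H - {e}) x y = cp H x y)"

definition spt_edges ::
  "'a set \<Rightarrow> 'a set set \<Rightarrow> ('a set set \<Rightarrow> 'a \<Rightarrow> 'a \<Rightarrow> 'a list) \<Rightarrow> 'a \<Rightarrow> 'a set set" where
  "spt_edges V E cp s = (\<Union>v\<in>{v\<in>V. connected_in V E s v}. path_edges (cp E s v))"

text \<open>Vertex set of the subtree T_G(s,e) below the tree edge e: the vertices
whose canonical path from s passes through e.\<close>

definition subtree_vertices ::
  "'a set \<Rightarrow> 'a set set \<Rightarrow> ('a set set \<Rightarrow> 'a \<Rightarrow> 'a \<Rightarrow> 'a list) \<Rightarrow> 'a \<Rightarrow> 'a set \<Rightarrow> 'a set" where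
  "subtree_vertices V E cp s e = {v\<in>V. connected_in V E s v \<and> e \<in> path_edges (cp E s v)}"

end

(* Deleting F only affects canonical paths through an edge of F, and a vertex
   outside S has a canonical path from s that avoids F; so for v outside S,
   pi_{G\F}(s,v) = pi_G(s,v).  The path pi_{G\F}(s,t) starts at s, which is outside S,
   and ends in S; let {x,y} be the edge on which it first enters S.  Since canonical
   paths are simple and closed under subpaths, the part up to x is
   pi_{G\F}(s,x) = pi_G(s,x) and the part from y is pi_{G\F}(y,t).  If that part
   reached a vertex z outside S, then pi_G(s,z) = pi_{G\F}(s,z) would pass through y,
   so z would lie in the subtree containing y, i.e. in S. *)

theory Submission
  imports Defs
begin

lemma path_edges_simps [simp]:
  "path_edges [] = {}" "path_edges [a] = {}"
  "path_edges (a # b # xs) = insert {a, b} (path_edges (b # xs))"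
  by (auto simp: path_edges_def)

lemma path_weight_simps [simp]:
  "path_weight w [] = 0" "path_weight w [a] = 0"
  "path_weight w (a # b # xs) = w {a, b} + path_weight w (b # xs)"
  by (auto simp: path_weight_def)

lemma path_edges_append:
  "path_edges (xs @ y # ys) = path_edges (xs @ [y]) \<union> path_edges (y # ys)"
  by (induction xs rule: induct_list012) auto

lemma path_weight_append:
  "path_weight w (xs @ y # ys) = path_weight w (xs @ [y]) + path_weight w (y # ys)"
  by (induction xs rule: induct_list012) auto

lemma path_edges_prefix: "path_edges xs \<subseteq> path_edges (xs @ ys)"
  by (induction xs rule: induct_list012) (auto simp: Cons_eq_append_conv)

lemma path_weight_nonneg:
  "path_edges xs \<subseteq> E \<Longrightarrow> \<forall>e\<in>E. 0 < w e \<Longrightarrow> 0 \<le> path_weight w xs"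
proof (induction xs rule: induct_list012)
  case (3 a b xs)
  then have "0 < w {a, b}" and "0 \<le> path_weight w (b # xs)"
    by auto
  then show ?case
    by simp
qed auto

lemma path_weight_pos:
  assumes "path_edges xs \<subseteq> E" "\<forall>e\<in>E. 0 < w e" "2 \<le> length xs"
  shows "0 < path_weight w xs"
proof -
  obtain a b ys where xs: "xs = a # b # ys"
    using \<open>2 \<le> length xs\<close> by (cases xs; cases "tl xs") auto
  then have "0 < w {a, b}" and "0 \<le> path_weight w (b # ys)"
    using assms path_weight_nonneg[of "b # ys" E w] by auto
  then show ?thesis
    using xs by simp
qed

lemma is_path_prefix: "is_path V H (xs @ z # ys) a b \<Longrightarrow> is_path V H (xs @ [z]) a z"
  unfolding is_path_def using path_edges_prefix[of "xs @ [z]" ys] by (cases xs) auto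

lemma is_path_suffix: "is_path V H (xs @ z # ys) a b \<Longrightarrow> is_path V H (z # ys) z b"
  unfolding is_path_def using path_edges_append[of xs z ys] by auto

lemma is_path_append:
  assumes "is_path V H xs a b" "is_path V H ys b c"
  shows "is_path V H (xs @ tl ys) a c"
proof -
  obtain L R where "xs = L @ [b]" "ys = b # R"
    using assms unfolding is_path_def by (metis append_butlast_last_id list.collapse)
  then show ?thesis
    using assms path_edges_append[of L b R] unfolding is_path_def by (cases L) auto
qed

lemma connected_in_edge: "{a, b} \<in> H \<Longrightarrow> a \<in> V \<Longrightarrow> b \<in> V \<Longrightarrow> connected_in V H a b"
  unfolding connected_in_def is_path_def by (rule exI[of _ "[a, b]"]) auto

lemma connected_in_trans:
  "connected_in V H a b \<Longrightarrow> connected_in V H b c \<Longrightarrow> connected_in V H a c"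
  unfolding connected_in_def by (blast intro: is_path_append)

lemma connected_in_mono: "connected_in V H a b \<Longrightarrow> H \<subseteq> H' \<Longrightarrow> connected_in V H' a b"
  unfolding connected_in_def is_path_def by blast

lemma connected_in_vertices: "connected_in V H a b \<Longrightarrow> a \<in> V \<and> b \<in> V"
  unfolding connected_in_def is_path_def by (metis hd_in_set last_in_set subsetD)

lemma shortest_path_distinct:
  assumes sp: "is_shortest_path V H w xs a b" and pos: "\<forall>e\<in>H. 0 < w e"
  shows "distinct xs"
proof (rule ccontr)
  assume "\<not> distinct xs"
  then obtain p q r v where xs: "xs = p @ [v] @ q @ [v] @ r"
    using not_distinct_decomp by blast
  have path: "is_path V H xs a b"
    using sp unfolding is_shortest_path_def by auto
  have edges: "path_edges xs = path_edges (p @ [v]) \<union> path_edges (v # q @ [v]) \<union> path_edges (v # r)"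
    using xs path_edges_append[of p v "q @ v # r"] path_edges_append[of "v # q" v r] by auto
  have "path_weight w xs
      = path_weight w (p @ [v]) + path_weight w (v # q @ [v]) + path_weight w (v # r)"
    using xs path_weight_append[of w p v "q @ v # r"] path_weight_append[of w "v # q" v r] by auto
  moreover have "0 < path_weight w (v # q @ [v])"
    using path_weight_pos[of "v # q @ [v]" H w] edges path pos unfolding is_path_def by auto
  moreover have "is_path V H (p @ v # r) a b"
    using path edges path_edges_append[of p v r] unfolding is_path_def xs by (cases p) auto
  then have "path_weight w xs \<le> path_weight w (p @ [v]) + path_weight w (v # r)"
    using sp path_weight_append[of w p v r] unfolding is_shortest_path_def by auto
  ultimately show False by linarith
qed

locale canonical_path_system =
  fixes V :: "'a set" and E :: "'a set set" and w :: "'a set \<Rightarrow> real"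
    and cp :: "'a set set \<Rightarrow> 'a \<Rightarrow> 'a \<Rightarrow> 'a list"
  assumes graph: "wf_graph V E w"
    and canon: "canonical_paths V E w cp"
begin

lemma finite_E: "finite E"
proof -
  have "E \<subseteq> Pow V" and "finite V"
    using graph unfolding wf_graph_def by auto
  then show ?thesis
    by (meson finite_Pow_iff finite_subset)
qed

lemma cp_shortest:
  "H \<subseteq> E \<Longrightarrow> connected_in V H a b \<Longrightarrow> is_shortest_path V H w (cp H a b) a b"
  using conjunct1[OF canon[unfolded canonical_paths_def]] by blast

lemma cp_path: "H \<subseteq> E \<Longrightarrow> connected_in V H a b \<Longrightarrow> is_path V H (cp H a b) a b"
  using cp_shortest unfolding is_shortest_path_def by blast

lemma weight_pos: "e \<in> E \<Longrightarrow> 0 < w e"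
  using graph unfolding wf_graph_def by blast

lemma cp_distinct:
  assumes "H \<subseteq> E" "connected_in V H a b"
  shows "distinct (cp H a b)"
  using shortest_path_distinct[OF cp_shortest[OF assms]] weight_pos assms(1) by blast

lemma cp_subpath:
  "H \<subseteq> E \<Longrightarrow> connected_in V H a b \<Longrightarrow> z \<in> set (cp H a b) \<Longrightarrow>
    cp H a b = cp H a z @ tl (cp H z b)"
  using conjunct1[OF conjunct2[OF canon[unfolded canonical_paths_def]]] by blast

lemma cp_delete_edge:
  "H \<subseteq> E \<Longrightarrow> connected_in V H a b \<Longrightarrow> e \<notin> path_edges (cp H a b) \<Longrightarrow>
    cp (H - {e}) a b = cp H a b"
  using conjunct2[OF conjunct2[OF canon[unfolded canonical_paths_def]]] by blast

lemma cp_refl: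
  assumes "H \<subseteq> E" "a \<in> V"
  shows "cp H a a = [a]"
proof -
  have trivial: "is_path V H [a] a a"
    using \<open>a \<in> V\<close> unfolding is_path_def by auto
  then have sp: "is_shortest_path V H w (cp H a a) a a"
    using assms cp_shortest unfolding connected_in_def by blast
  then have "path_weight w (cp H a a) \<le> 0"
    using trivial unfolding is_shortest_path_def by fastforce
  moreover have "path_edges (cp H a a) \<subseteq> E"
    using sp \<open>H \<subseteq> E\<close> unfolding is_shortest_path_def is_path_def by auto
  ultimately have "length (cp H a a) < 2"
    using path_weight_pos[of "cp H a a" E w] weight_pos by fastforce
  with sp show ?thesis
    unfolding is_shortest_path_def is_path_def
    by (cases "cp H a a") (auto simp: less_Suc_eq)
qed

lemma connected_in_cp_vertex:
  assumes "H \<subseteq> E" "connected_in V H a b" "z \<in> set (cp H a b)"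
  shows "connected_in V H a z" "connected_in V H z b"
proof -
  obtain L R where "cp H a b = L @ z # R"
    using \<open>z \<in> set (cp H a b)\<close> split_list by metis
  then show "connected_in V H a z" "connected_in V H z b"
    using cp_path[OF assms(1,2)] is_path_prefix is_path_suffix
    unfolding connected_in_def by metis+
qed

lemma cp_split:
  assumes H: "H \<subseteq> E" and ab: "connected_in V H a b" and P: "cp H a b = L @ z # R"
  shows "cp H a z = L @ [z]" "cp H z b = z # R"
proof -
  have z: "z \<in> set (cp H a b)"
    using P by simp
  obtain C where C: "cp H a z = C @ [z]"
    using cp_path[OF H connected_in_cp_vertex(1)[OF H ab z]] unfolding is_path_def
    by (metis append_butlast_last_id)
  obtain D where D: "cp H z b = z # D"
    using cp_path[OF H connected_in_cp_vertex(2)[OF H ab z]] unfolding is_path_def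
    by (metis list.collapse)
  have "L @ z # R = C @ z # D"
    using cp_subpath[OF H ab z] P C D by simp
  moreover have "z \<notin> set L" "z \<notin> set R"
    using cp_distinct[OF H ab] P by auto
  ultimately show "cp H a z = L @ [z]" "cp H z b = z # R"
    using C D append_Cons_eq_iff by metis+
qed

lemma cp_diff_edges:
  assumes H: "H \<subseteq> E" and ab: "connected_in V H a b"
    and avoid: "F \<inter> path_edges (cp H a b) = {}"
  shows "cp (H - F) a b = cp H a b"
proof -
  have "cp (H - G) a b = cp H a b" if "finite G" "G \<subseteq> F" for G
    using that
  proof (induction G rule: finite_induct)
    case (insert e G)
    then have IH: "cp (H - G) a b = cp H a b"
      by simp
    have "connected_in V (H - G) a b"
      using cp_path[OF H ab] insert.prems avoid
      unfolding connected_in_def is_path_def by blast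
    moreover have "e \<notin> path_edges (cp (H - G) a b)"
      using IH insert.prems avoid by auto
    ultimately have "cp (H - G - {e}) a b = cp (H - G) a b"
      using H by (intro cp_delete_edge) auto
    moreover have "H - insert e G = H - G - {e}"
      by blast
    ultimately show ?case
      using IH by simp
  qed simp
  \<comment> \<open>F itself may be infinite; only its edges inside the finite set H matter.\<close>
  moreover have "finite (F \<inter> H)"
    using H finite_E finite_subset by blast
  moreover have "H - F = H - (F \<inter> H)"
    by blast
  ultimately show ?thesis
    by (metis inf_le1)
qed

end

locale subtree_union = canonical_path_system +
  fixes s :: 'a and F :: "'a set set" and S :: "'a set"
  assumes source: "s \<in> V"
    and S_def: "S = (\<Union>e\<in>F. subtree_vertices V E cp s e)"
begin

lemma S_memD: "v \<in> S \<Longrightarrow> v \<in> V \<and> connected_in V E s v \<and> (\<exists>e\<in>F. e \<in> path_edges (cp E s v))"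
  unfolding S_def subtree_vertices_def by blast

lemma source_notin_S: "s \<notin> S"
  using S_memD cp_refl[OF subset_refl source] by fastforce

lemma S_closed_along_cp:
  assumes y: "y \<in> S" and z: "connected_in V E s z" and yz: "y \<in> set (cp E s z)"
  shows "z \<in> S"
proof -
  have "cp E s z = cp E s y @ tl (cp E y z)"
    using cp_subpath[OF subset_refl z yz] .
  then have "path_edges (cp E s y) \<subseteq> path_edges (cp E s z)"
    by (metis path_edges_prefix)
  moreover obtain e where "e \<in> F" "e \<in> path_edges (cp E s y)"
    using S_memD[OF y] by blast
  ultimately have "z \<in> subtree_vertices V E cp s e"
    using z connected_in_vertices[OF z] unfolding subtree_vertices_def by blast
  then show ?thesis
    using \<open>e \<in> F\<close> unfolding S_def by blast
qed

lemma cp_diff_outside_S: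
  assumes sv: "connected_in V E s v" and v: "v \<notin> S"
  shows "cp (E - F) s v = cp E s v"
proof (rule cp_diff_edges[OF subset_refl sv])
  have "v \<notin> subtree_vertices V E cp s e" if "e \<in> F" for e
    using v that unfolding S_def by blast
  then show "F \<inter> path_edges (cp E s v) = {}"
    using sv connected_in_vertices[OF sv] unfolding subtree_vertices_def by blast
qed

lemma entry_edge_exists:
  assumes t: "t \<in> S" and st: "connected_in V (E - F) s t"
  shows "\<exists>x y. x \<in> V - S \<and> y \<in> S \<and> {x, y} \<in> E \<and> {x, y} \<notin> F \<and>
           cp (E - F) s t = cp E s x @ cp (E - F) y t"
proof -
  let ?P = "cp (E - F) s t"
  have path: "is_path V (E - F) ?P s t"
    using cp_path[OF Diff_subset st] .
  then have "t \<in> set ?P"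
    unfolding is_path_def by (metis last_in_set)
  then obtain L y R where P: "?P = L @ y # R" and y: "y \<in> S" and L: "\<forall>v\<in>set L. v \<notin> S"
    using t split_list_first_prop[of ?P "\<lambda>v. v \<in> S"] by blast
  have "L \<noteq> []"
    using path P y source_notin_S unfolding is_path_def by (metis list.sel(1) self_append_conv2)
  then obtain A x where "L = A @ [x]"
    by (metis rev_exhaust)
  with P L have P': "?P = A @ x # y # R" and "x \<notin> S"
    by auto
  then have x: "x \<in> V - S"
    using path unfolding is_path_def by auto
  have "{x, y} \<in> path_edges ?P"
    using P' path_edges_append[of A x "y # R"] by simp
  then have xy: "{x, y} \<in> E" "{x, y} \<notin> F"
    using path unfolding is_path_def by auto
  have cpx: "cp (E - F) s x = A @ [x]"
    using cp_split(1)[OF Diff_subset st P'] .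
  have cpy: "cp (E - F) y t = y # R"
    using cp_split(2)[OF Diff_subset st, of "A @ [x]"] P' by simp
  have "connected_in V (E - F) s x"
    using connected_in_cp_vertex(1)[OF Diff_subset st] P' by simp
  then have "connected_in V E s x"
    by (rule connected_in_mono[OF _ Diff_subset])
  then have "cp (E - F) s x = cp E s x"
    using cp_diff_outside_S x by blast
  then have "?P = cp E s x @ cp (E - F) y t"
    using P' cpx cpy by simp
  then show ?thesis
    using x y xy by blast
qed

lemma entry_suffix_subset_S:
  assumes x: "x \<in> V - S" and y: "y \<in> S" and xy: "{x, y} \<in> E" "{x, y} \<notin> F"
    and P: "cp (E - F) s t = cp E s x @ cp (E - F) y t"
    and st: "connected_in V (E - F) s t"
  shows "set (cp (E - F) y t) \<subseteq> S"
proof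
  fix z
  assume z: "z \<in> set (cp (E - F) y t)"
  have yx: "{y, x} \<in> E - F"
    using xy by (simp add: insert_commute)
  have yV: "y \<in> V" and sy: "connected_in V E s y"
    using S_memD[OF y] by auto
  have "connected_in V E s x"
    using connected_in_trans[OF sy connected_in_edge[of y x]] yx yV x by blast
  then obtain A where A: "cp E s x = A @ [x]"
    using cp_path[OF subset_refl] unfolding is_path_def by (metis append_butlast_last_id)
  have "connected_in V (E - F) x t"
    using connected_in_cp_vertex(2)[OF Diff_subset st] P A by simp
  \<comment> \<open>cp is arbitrary on disconnected pairs, so this is needed to read off y # Q.\<close>
  then have yt: "connected_in V (E - F) y t"
    using connected_in_trans[OF connected_in_edge[OF yx yV]] x by blast
  obtain Q where Q: "cp (E - F) y t = y # Q"
    using cp_path[OF Diff_subset yt] unfolding is_path_def by (metis list.collapse)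
  obtain Q1 Q2 where Q12: "y # Q = Q1 @ z # Q2"
    using z Q split_list by metis
  have P': "cp (E - F) s t = (A @ x # Q1) @ z # Q2"
    using P A Q Q12 by simp
  have "y \<in> set (Q1 @ [z])"
    using Q12 by (cases Q1) auto
  then have y_before_z: "y \<in> set (cp (E - F) s z)"
    using cp_split(1)[OF Diff_subset st P'] by auto
  show "z \<in> S"
  proof (rule ccontr)
    assume z_out: "z \<notin> S"
    have "connected_in V (E - F) s z"
      using connected_in_cp_vertex(1)[OF Diff_subset st] P' by simp
    then have sz: "connected_in V E s z"
      by (rule connected_in_mono[OF _ Diff_subset])
    then have "y \<in> set (cp E s z)"
      using y_before_z cp_diff_outside_S[OF sz z_out] by simp
    then show False
      using S_closed_along_cp[OF y sz] z_out by blast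
  qed
qed

end

theorem proposition6:
  fixes V :: "'a set" and E :: "'a set set" and w :: "'a set \<Rightarrow> real"
    and cp :: "'a set set \<Rightarrow> 'a \<Rightarrow> 'a \<Rightarrow> 'a list"
    and s t :: 'a and F :: "'a set set" and S :: "'a set"
  assumes graph: "wf_graph V E w"
    and canon: "canonical_paths V E w cp"
    and sV: "s \<in> V" and tV: "t \<in> V"
    and F_tree: "F \<subseteq> spt_edges V E cp s"
    and F_disj: "\<forall>e\<in>F. \<forall>e'\<in>F. e \<noteq> e' \<longrightarrow>
                   subtree_vertices V E cp s e \<inter> subtree_vertices V E cp s e' = {}"
    and S_def: "S = (\<Union>e\<in>F. subtree_vertices V E cp s e)"
    and tS: "t \<in> S"
    and conn: "connected_in V (E - F) s t"
  shows "(\<exists>x y. x \<in> V - S \<and> y \<in> S \<and> {x, y} \<in> E \<and> {x, y} \<notin> F \<and>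
            cp (E - F) s t = cp E s x @ cp (E - F) y t)
       \<and> (\<forall>x y. x \<in> V - S \<and> y \<in> S \<and> {x, y} \<in> E \<and> {x, y} \<notin> F \<and>
            cp (E - F) s t = cp E s x @ cp (E - F) y t \<longrightarrow>
            set (cp (E - F) y t) \<subseteq> S)"
proof -
  interpret subtree_union V E w cp s F S
    using graph canon sV S_def by unfold_locales
  show ?thesis
  proof (intro conjI allI impI)
    show "\<exists>x y. x \<in> V - S \<and> y \<in> S \<and> {x, y} \<in> E \<and> {x, y} \<notin> F \<and>
            cp (E - F) s t = cp E s x @ cp (E - F) y t"
      by (rule entry_edge_exists[OF tS conn])
  next
    fix x y
    assume xy: "x \<in> V - S \<and> y \<in> S \<and> {x, y} \<in> E \<and> {x, y} \<notin> F \<and>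
            cp (E - F) s t = cp E s x @ cp (E - F) y t"
    show "set (cp (E - F) y t) \<subseteq> S"
      by (rule entry_suffix_subset_S) (use xy conn in auto)
  qed
qed

end
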